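(* Let $p>q>0$ be real numbers. Then the improper integrals below converge and $$I_{p,q}^{\pm}:=\int_0^\infty e^{\pm ix^p}x^{q-1}\,dx=p^{-1}e^{\pm i\frac{\pi}{2}\frac{q}{p}}\,\Gamma\!\left(\frac{q}{p}\right),$$ where $\Gamma$ is the Gamma function and the double signs $\pm$ are in the same order.
   Context: The integral is an improper integral, $\int_0^\infty f(x)\,dx=\lim_{u\to+0,\,v\to\infty}\int_u^v f(x)\,dx$. *)

theory Defs
  imports "HOL-Analysis.Analysis"
begin

text \<open>
  The improper integral over $(0,\infty)$ is the joint limit of the integrals over $[u,v]$ as
  $u \to {+}0$ and $v \to \infty$ independently (product filter). Convergence also demands
  integrability on every such $[u,v]$, since \<open>integral\<close> is zero on non-integrable functions.
\<close>

definition has_improper_integral :: "(real \<Rightarrow> complex) \<Rightarrow> complex \<Rightarrow> bool" where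
  "has_improper_integral f I \<longleftrightarrow>
     (\<forall>u v. 0 < u \<and> u \<le> v \<longrightarrow> f integrable_on {u..v}) \<and>
     ((\<lambda>(u, v). integral {u..v} f) \<longlongrightarrow> I) (at_right 0 \<times>\<^sub>F at_top)"

definition improper_integral_converges :: "(real \<Rightarrow> complex) \<Rightarrow> bool" where
  "improper_integral_converges f \<longleftrightarrow> (\<exists>I. has_improper_integral f I)"

definition improper_integral :: "(real \<Rightarrow> complex) \<Rightarrow> complex" where
  "improper_integral f = Lim (at_right 0 \<times>\<^sub>F at_top) (\<lambda>(u, v). integral {u..v} f)"

definition I_plus_integrand :: "real \<Rightarrow> real \<Rightarrow> real \<Rightarrow> complex" where
  "I_plus_integrand p q x = exp (\<i> * of_real (x powr p)) * of_real (x powr (q - 1))"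

definition I_minus_integrand :: "real \<Rightarrow> real \<Rightarrow> real \<Rightarrow> complex" where
  "I_minus_integrand p q x = exp (- \<i> * of_real (x powr p)) * of_real (x powr (q - 1))"

definition I_plus :: "real \<Rightarrow> real \<Rightarrow> complex" where
  "I_plus p q = improper_integral (I_plus_integrand p q)"

definition I_minus :: "real \<Rightarrow> real \<Rightarrow> complex" where
  "I_minus p q = improper_integral (I_minus_integrand p q)"

end

theory Submission
  imports Defs "HOL-Complex_Analysis.Cauchy_Integral_Theorem" "HOL-Real_Asymp.Real_Asymp"
begin

text \<open>
  Put \<open>a = q / p\<close>. The function \<open>g w = exp (\<i> * exp w + a * w)\<close> is entire, so it has a primitive
  \<open>G\<close>. Substituting \<open>w = p * ln x\<close> turns the integrand of the lemma into \<open>g\<close> on the real line,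
  while on the horizontal line of height \<open>pi / 2\<close> the function \<open>g\<close> is, up to the phase
  \<open>exp (\<i> * pi / 2 * a)\<close>, the Euler integrand \<open>t powr (a - 1) * exp (- t)\<close> for \<open>t = exp s\<close>.
  The increments of \<open>G\<close> along the vertical segments joining the two lines tend to \<open>0\<close> in both
  directions: trivially on the left, and by Jordan's inequality \<open>sin y \<ge> 2 * y / pi\<close> on the
  right, where \<open>a < 1\<close> is needed. The other sign is obtained by conjugation.
\<close>

lemma has_integral_imp_tendsto_product:
  fixes f :: "real \<Rightarrow> 'a::banach"
  assumes "(f has_integral I) {0..}"
  shows "((\<lambda>(u, v). integral {u..v} f) \<longlongrightarrow> I) (at_right 0 \<times>\<^sub>F at_top)"
proof -
  let ?f0 = "\<lambda>x. if x \<in> {0..} then f x else 0"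
  have restrict: "integral {-v..v} ?f0 = integral {0..v} f" for v :: real
  proof -
    have "{0..} \<inter> {-v..v} = {0..v}" by auto
    then show ?thesis
      by (metis integral_restrict_Int inf_commute)
  qed
  have integrable: "f integrable_on {0..v}" for v
    using integrable_on_subinterval[of f "{0..}" 0 v] assms by (auto simp: integrable_on_def)
  have at_inf: "((\<lambda>v. integral {0..v} f) \<longlongrightarrow> I) at_top"
  proof (rule tendstoI)
    fix e :: real assume "e > 0"
    then obtain B where "B > 0"
      and B: "\<And>a b. ball 0 B \<subseteq> cbox a b \<Longrightarrow> norm (integral (cbox a b) ?f0 - I) < e"
      using assms unfolding has_integral_alt' by metis
    have "dist (integral {0..v} f) I < e" if "v \<ge> B" for v
    proof -
      have "ball 0 B \<subseteq> cbox (-v) v"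
        using that by (auto simp: dist_norm)
      from B[OF this] show ?thesis
        by (simp only: box_real restrict dist_norm)
    qed
    then show "\<forall>\<^sub>F v in at_top. dist (integral {0..v} f) I < e"
      unfolding eventually_at_top_linorder by blast
  qed
  have at_0: "((\<lambda>u. integral {0..u} f) \<longlongrightarrow> 0) (at_right 0)"
  proof -
    have "continuous_on {0..1} (\<lambda>u. integral {0..u} f)"
      by (rule indefinite_integral_continuous_1[OF integrable])
    then have "((\<lambda>u. integral {0..u} f) \<longlongrightarrow> integral {0..0} f) (at 0 within {0..1})"
      unfolding continuous_on_def by (rule bspec) simp
    then show ?thesis
      by (simp add: at_within_Icc_at_right)
  qed
  have "((\<lambda>z. integral {0..snd z} f - integral {0..fst z} f) \<longlongrightarrow> I - 0) (at_right 0 \<times>\<^sub>F at_top)"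
    by (intro tendsto_diff filterlim_compose[OF at_inf filterlim_snd]
          filterlim_compose[OF at_0 filterlim_fst])
  moreover have "\<forall>\<^sub>F z in at_right 0 \<times>\<^sub>F at_top.
      integral {0..snd z} f - integral {0..fst z} f = (case z of (u, v) \<Rightarrow> integral {u..v} f)"
  proof -
    have "\<forall>\<^sub>F z in at_right 0 \<times>\<^sub>F at_top. fst z \<in> {0<..<1::real} \<and> snd z \<ge> (1::real)"
      by (intro eventually_prodI eventually_at_right_real eventually_ge_at_top) simp
    then show ?thesis
    proof eventually_elim
      case (elim z)
      then show ?case
        using Henstock_Kurzweil_Integration.integral_combine[of 0 "fst z" "snd z" f, OF _ _ integrable]
        by (auto simp: case_prod_beta algebra_simps)
    qed
  qed
  ultimately show ?thesis
    using Lim_transform_eventually by fastforce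
qed

lemma sin_ge_two_div_pi_times:
  assumes "0 \<le> x" "x \<le> pi / 2"
  shows "sin x \<ge> 2 / pi * x"
proof -
  have "concave_on {0..pi / 2} sin"
  proof (rule f''_le0_imp_concave)
    show "(cos has_real_derivative - sin y) (at y)" for y
      by (rule DERIV_cos)
    show "- sin y \<le> 0" if "y \<in> {0..pi / 2}" for y
      using that by (auto intro!: sin_ge_zero)
  qed (auto intro: DERIV_sin)
  from concave_onD_Icc'[OF this, of x] assms show ?thesis
    by simp
qed

lemma vertical_increment_le:
  fixes G g :: "complex \<Rightarrow> complex" and \<phi> :: "real \<Rightarrow> real"
  assumes "b > 0"
    and G: "\<And>w. (G has_field_derivative g w) (at w)"
    and \<phi>: "\<And>y. (\<phi> has_real_derivative \<phi>' y) (at y)"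
    and bnd: "\<And>y. 0 < y \<Longrightarrow> y < b \<Longrightarrow> norm (g (Complex s y)) \<le> \<phi>' y"
  shows "norm (G (Complex s b) - G (Complex s 0)) \<le> \<phi> b - \<phi> 0"
proof (rule differentiable_bound_general[OF \<open>b > 0\<close>])
  have G': "((\<lambda>y. G (Complex s y)) has_vector_derivative \<i> * g (Complex s y)) (at y)" for y
  proof -
    have "((\<lambda>y. of_real s + \<i> * of_real y) has_vector_derivative \<i>) (at y)"
      by (auto intro!: derivative_eq_intros)
    from field_vector_diff_chain_at[OF this G] show ?thesis
      by (simp add: o_def Complex_eq)
  qed
  then show "((\<lambda>y. G (Complex s y)) has_vector_derivative \<i> * g (Complex s y)) (at y)" for y .
  show "(\<phi> has_vector_derivative \<phi>' y) (at y)" for y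
    using \<phi>[of y] by (simp add: has_real_derivative_iff_has_vector_derivative)
  show "continuous_on {0..b} (\<lambda>y. G (Complex s y))"
    by (intro continuous_at_imp_continuous_on ballI has_vector_derivative_continuous[OF G'])
  show "continuous_on {0..b} \<phi>"
    by (intro continuous_at_imp_continuous_on ballI DERIV_isCont[OF \<phi>])
  show "norm (\<i> * g (Complex s y)) \<le> \<phi>' y" if "0 < y" "y < b" for y
    using bnd[OF that] by (simp add: norm_mult)
qed

definition euler_fun :: "real \<Rightarrow> complex \<Rightarrow> complex" where
  "euler_fun a w = exp (\<i> * exp w + of_real a * w)"

lemma euler_fun_primitive:
  obtains G where "\<And>w. (G has_field_derivative euler_fun a w) (at w)"
proof -
  have "euler_fun a holomorphic_on UNIV"
    unfolding euler_fun_def by (intro holomorphic_intros)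
  then show ?thesis
    using holomorphic_convex_primitive'[of UNIV "euler_fun a"] that by auto
qed

lemma norm_euler_fun: "norm (euler_fun a (Complex s y)) = exp (a * s - exp s * sin y)"
  by (simp add: euler_fun_def Re_exp Im_exp)

lemma euler_fun_ln:
  assumes "t > 0"
  shows "euler_fun a (of_real (ln t)) = exp (\<i> * of_real t) * of_real (t powr a)"
proof -
  have "exp (complex_of_real (ln t)) = of_real t"
    using assms by (simp add: exp_of_real)
  moreover have "exp (of_real (a * ln t)) = complex_of_real (t powr a)"
    using assms by (simp add: powr_def flip: exp_of_real)
  ultimately show ?thesis
    by (simp add: euler_fun_def exp_add)
qed

lemma euler_fun_ln_plus:
  assumes "t > 0"
  shows "euler_fun a (Complex (ln t) (pi / 2)) =
           exp (\<i> * of_real (pi / 2 * a)) * of_real (t powr a / exp t)"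
proof -
  have "exp (Complex (ln t) (pi / 2)) = \<i> * of_real t"
    using assms by (simp add: complex_eq_iff Re_exp Im_exp)
  then have "\<i> * exp (Complex (ln t) (pi / 2)) + of_real a * Complex (ln t) (pi / 2) =
      \<i> * of_real (pi / 2 * a) + of_real (a * ln t - t)"
    by (simp add: complex_eq_iff)
  then have "euler_fun a (Complex (ln t) (pi / 2)) =
      exp (\<i> * of_real (pi / 2 * a)) * of_real (exp (a * ln t - t))"
    by (simp only: euler_fun_def exp_add exp_of_real)
  also have "exp (a * ln t - t) = t powr a / exp t"
    using assms by (simp add: powr_def exp_diff)
  finally show ?thesis .
qed

context
  fixes a :: real and G :: "complex \<Rightarrow> complex"
  assumes a: "0 < a" "a < 1"
    and G: "\<And>w. (G has_field_derivative euler_fun a w) (at w)"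
begin

lemma vertical_increment_at_top:
  "((\<lambda>s. G (Complex s (pi / 2)) - G (Complex s 0)) \<longlongrightarrow> 0) at_top"
proof (rule Lim_null_comparison)
  show "\<forall>\<^sub>F s in at_top. norm (G (Complex s (pi / 2)) - G (Complex s 0)) \<le> pi / 2 * exp ((a - 1) * s)"
  proof (rule always_eventually, rule allI)
    fix s
    let ?\<phi> = "\<lambda>y. - (pi / 2 * exp ((a - 1) * s) * exp (- (exp s * (2 / pi * y))))"
    have "norm (G (Complex s (pi / 2)) - G (Complex s 0)) \<le> ?\<phi> (pi / 2) - ?\<phi> 0"
    proof (rule vertical_increment_le[OF _ G])
      show "(?\<phi> has_real_derivative exp (a * s - exp s * (2 / pi * y))) (at y)" for y
        by (rule derivative_eq_intros refl)+
           (simp add: field_simps flip: exp_add exp_diff)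
      show "norm (euler_fun a (Complex s y)) \<le> exp (a * s - exp s * (2 / pi * y))"
        if "0 < y" "y < pi / 2" for y
        using sin_ge_two_div_pi_times[of y] that
        unfolding norm_euler_fun exp_le_cancel_iff
        by (intro diff_left_mono mult_left_mono) auto
    qed simp
    also have "\<dots> \<le> pi / 2 * exp ((a - 1) * s)"
      by simp
    finally show "norm (G (Complex s (pi / 2)) - G (Complex s 0)) \<le> pi / 2 * exp ((a - 1) * s)" .
  qed
  show "((\<lambda>s. pi / 2 * exp ((a - 1) * s)) \<longlongrightarrow> 0) at_top"
    using a by real_asymp
qed

lemma vertical_increment_at_bot:
  "((\<lambda>s. G (Complex s (pi / 2)) - G (Complex s 0)) \<longlongrightarrow> 0) at_bot"
proof (rule Lim_null_comparison)
  show "\<forall>\<^sub>F s in at_bot. norm (G (Complex s (pi / 2)) - G (Complex s 0)) \<le> exp (a * s) * (pi / 2)"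
  proof (rule always_eventually, rule allI)
    fix s
    have "norm (G (Complex s (pi / 2)) - G (Complex s 0)) \<le> exp (a * s) * (pi / 2) - exp (a * s) * 0"
    proof (rule vertical_increment_le[OF _ G])
      show "((\<lambda>y. exp (a * s) * y) has_real_derivative exp (a * s)) (at y)" for y
        by (rule derivative_eq_intros refl)+ simp
      show "norm (euler_fun a (Complex s y)) \<le> exp (a * s)" if "0 < y" "y < pi / 2" for y
        using that by (simp add: norm_euler_fun sin_ge_zero)
    qed simp
    then show "norm (G (Complex s (pi / 2)) - G (Complex s 0)) \<le> exp (a * s) * (pi / 2)"
      by simp
  qed
  show "((\<lambda>s. exp (a * s) * (pi / 2)) \<longlongrightarrow> 0) at_bot"
    using a by real_asymp
qed

lemma increment_upper_line:
  assumes "0 < u" "u \<le> v"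
  shows "G (Complex (ln v) (pi / 2)) - G (Complex (ln u) (pi / 2)) =
           exp (\<i> * of_real (pi / 2 * a)) * of_real (integral {u..v} (\<lambda>t. t powr (a - 1) / exp t))"
proof -
  let ?c = "exp (\<i> * of_real (pi / 2 * a))" and ?h = "\<lambda>t. t powr (a - 1) / exp t"
  have "((\<lambda>t. ?c * of_real (?h t)) has_integral
          (G (Complex (ln v) (pi / 2)) - G (Complex (ln u) (pi / 2)))) {u..v}"
  proof (rule fundamental_theorem_of_calculus[OF \<open>u \<le> v\<close>])
    fix t assume "t \<in> {u..v}"
    then have t: "t > 0" using assms by auto
    have "((\<lambda>t. of_real (ln t) + \<i> * of_real (pi / 2)) has_vector_derivative of_real (1 / t)) (at t)"
      using t by (auto intro!: derivative_eq_intros)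
    from field_vector_diff_chain_at[OF this G]
    have "((\<lambda>t. G (Complex (ln t) (pi / 2))) has_vector_derivative
            of_real (1 / t) * euler_fun a (Complex (ln t) (pi / 2))) (at t)"
      by (simp add: o_def Complex_eq)
    also have "of_real (1 / t) * euler_fun a (Complex (ln t) (pi / 2)) = ?c * of_real (?h t)"
      using t by (simp add: euler_fun_ln_plus powr_diff field_simps)
    finally show "((\<lambda>t. G (Complex (ln t) (pi / 2))) has_vector_derivative ?c * of_real (?h t))
        (at t within {u..v})"
      by (rule has_vector_derivative_at_within)
  qed
  moreover have "?h integrable_on {u..v}"
    using assms by (intro integrable_continuous_interval continuous_intros) auto
  then have "((\<lambda>t. ?c * of_real (?h t)) has_integral ?c * of_real (integral {u..v} ?h)) {u..v}"
    by (intro has_integral_mult_right has_integral_of_real integrable_integral)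
  ultimately show ?thesis
    by (rule has_integral_unique)
qed

lemma increment_lower_line_tendsto:
  "((\<lambda>(u, v). G (Complex (ln v) 0) - G (Complex (ln u) 0))
      \<longlongrightarrow> exp (\<i> * of_real (pi / 2 * a)) * of_real (Gamma a)) (at_right 0 \<times>\<^sub>F at_top)"
proof -
  let ?F = "at_right (0::real) \<times>\<^sub>F (at_top :: real filter)"
  let ?c = "exp (\<i> * of_real (pi / 2 * a))" and ?h = "\<lambda>t. t powr (a - 1) / exp t"
  let ?D = "\<lambda>s. G (Complex s (pi / 2)) - G (Complex s 0)"
  have D_top: "((\<lambda>z. ?D (ln (snd z))) \<longlongrightarrow> 0) ?F"
    by (rule filterlim_compose[OF vertical_increment_at_top filterlim_compose[OF ln_at_top filterlim_snd]])
  have D_bot: "((\<lambda>z. ?D (ln (fst z))) \<longlongrightarrow> 0) ?F"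
    by (rule filterlim_compose[OF vertical_increment_at_bot filterlim_compose[OF ln_at_0 filterlim_fst]])
  have "((\<lambda>(u, v). integral {u..v} ?h) \<longlongrightarrow> Gamma a) ?F"
    by (rule has_integral_imp_tendsto_product[OF Gamma_integral_real[OF a(1)]])
  then have "((\<lambda>z. ?c * of_real (integral {fst z..snd z} ?h)) \<longlongrightarrow> ?c * of_real (Gamma a)) ?F"
    by (intro tendsto_intros) (simp add: case_prod_unfold)
  from tendsto_add[OF tendsto_diff[OF this D_top] D_bot]
  have "((\<lambda>z. ?c * of_real (integral {fst z..snd z} ?h) - ?D (ln (snd z)) + ?D (ln (fst z)))
          \<longlongrightarrow> ?c * of_real (Gamma a)) ?F"
    by simp
  moreover have "\<forall>\<^sub>F z in ?F.
      ?c * of_real (integral {fst z..snd z} ?h) - ?D (ln (snd z)) + ?D (ln (fst z)) =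
      (case z of (u, v) \<Rightarrow> G (Complex (ln v) 0) - G (Complex (ln u) 0))"
  proof -
    have "\<forall>\<^sub>F z in ?F. fst z \<in> {0<..<1::real} \<and> snd z \<ge> (1::real)"
      by (intro eventually_prodI eventually_at_right_real eventually_ge_at_top) simp
    then show ?thesis
    proof eventually_elim
      case (elim z)
      then show ?case
        by (subst increment_upper_line[symmetric]) (auto simp: case_prod_beta)
    qed
  qed
  ultimately show ?thesis
    using Lim_transform_eventually by fastforce
qed

end

lemma has_improper_integral_I_plus:
  assumes "p > q" "q > 0"
  shows "has_improper_integral (I_plus_integrand p q)
    (of_real (1 / p) * exp (\<i> * of_real (pi / 2 * (q / p))) * of_real (Gamma (q / p)))"
proof -
  define a where "a = q / p"
  have p: "p > 0" and a: "0 < a" "a < 1"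
    using assms by (auto simp: a_def)
  obtain G where G: "\<And>w. (G has_field_derivative euler_fun a w) (at w)"
    using euler_fun_primitive by blast
  let ?F = "at_right (0::real) \<times>\<^sub>F (at_top :: real filter)"
  let ?P = "\<lambda>x. of_real (1 / p) * G (Complex (ln (x powr p)) 0)"
  have ftc: "(I_plus_integrand p q has_integral (?P v - ?P u)) {u..v}" if "0 < u" "u \<le> v" for u v
  proof (rule fundamental_theorem_of_calculus[OF \<open>u \<le> v\<close>])
    fix x assume "x \<in> {u..v}"
    then have x: "x > 0" using that by auto
    have "((\<lambda>x. complex_of_real (ln (x powr p))) has_vector_derivative of_real (p / x)) (at x)"
      using x by (intro has_vector_derivative_of_real)
        (auto intro!: derivative_eq_intros simp flip: has_real_derivative_iff_has_vector_derivative)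
    from has_vector_derivative_mult_right[OF field_vector_diff_chain_at[OF this G], of "of_real (1 / p)"]
    have "(?P has_vector_derivative
            of_real (1 / p) * (of_real (p / x) * euler_fun a (of_real (ln (x powr p))))) (at x)"
      by (simp add: o_def complex_of_real_def)
    also have "of_real (1 / p) * (of_real (p / x) * euler_fun a (of_real (ln (x powr p)))) =
        I_plus_integrand p q x"
    proof -
      have "(x powr p) powr a = x powr q"
        using p by (simp add: powr_powr a_def)
      then show ?thesis
        using x p euler_fun_ln[of "x powr p" a] by (simp add: I_plus_integrand_def powr_diff)
    qed
    finally show "(?P has_vector_derivative I_plus_integrand p q x) (at x within {u..v})"
      by (rule has_vector_derivative_at_within)
  qed
  have "filterlim (\<lambda>x. x powr p) (at_right 0) (at_right 0)" "filterlim (\<lambda>x. x powr p) at_top at_top"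
    using p by real_asymp+
  then have "filterlim (\<lambda>z. (fst z powr p, snd z powr p)) ?F ?F"
    by (intro filterlim_Pair) (auto intro: filterlim_compose filterlim_fst filterlim_snd)
  from filterlim_compose[OF increment_lower_line_tendsto[OF a G] this]
  have "((\<lambda>z. of_real (1 / p) * (G (Complex (ln (snd z powr p)) 0) - G (Complex (ln (fst z powr p)) 0)))
      \<longlongrightarrow> of_real (1 / p) * (exp (\<i> * of_real (pi / 2 * a)) * of_real (Gamma a))) ?F"
    by (intro tendsto_mult_left) simp
  moreover have "\<forall>\<^sub>F z in ?F.
      of_real (1 / p) * (G (Complex (ln (snd z powr p)) 0) - G (Complex (ln (fst z powr p)) 0)) =
      (case z of (u, v) \<Rightarrow> integral {u..v} (I_plus_integrand p q))"
  proof -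
    have "\<forall>\<^sub>F z in ?F. fst z \<in> {0<..<1::real} \<and> snd z \<ge> (1::real)"
      by (intro eventually_prodI eventually_at_right_real eventually_ge_at_top) simp
    then show ?thesis
    proof eventually_elim
      case (elim z)
      then show ?case
        using integral_unique[OF ftc[of "fst z" "snd z"]]
        by (simp add: case_prod_beta right_diff_distrib)
    qed
  qed
  ultimately have "((\<lambda>(u, v). integral {u..v} (I_plus_integrand p q))
      \<longlongrightarrow> of_real (1 / p) * (exp (\<i> * of_real (pi / 2 * a)) * of_real (Gamma a))) ?F"
    using Lim_transform_eventually by fastforce
  then show ?thesis
    unfolding has_improper_integral_def using ftc by (auto simp: a_def mult.assoc)
qed

lemma has_improper_integral_cnj:
  assumes "has_improper_integral f I"
  shows "has_improper_integral (\<lambda>x. cnj (f x)) (cnj I)"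
  using assms tendsto_cnj[of "\<lambda>(u, v). integral {u..v} f" I]
  by (simp add: has_improper_integral_def integrable_on_cnj_iff case_prod_unfold flip: integral_cnj)

lemma improper_integral_eq:
  assumes "has_improper_integral f I"
  shows "improper_integral f = I"
  using assms unfolding has_improper_integral_def improper_integral_def
  by (intro tendsto_Lim) (auto simp: prod_filter_eq_bot)

lemma I_minus_integrand_eq_cnj: "I_minus_integrand p q = (\<lambda>x. cnj (I_plus_integrand p q x))"
  by (simp add: fun_eq_iff I_minus_integrand_def I_plus_integrand_def exp_cnj)

theorem lemma4p1:
  fixes p q :: real
  assumes "p > q" and "q > 0"
  shows "improper_integral_converges (I_plus_integrand p q) \<and>
         I_plus p q = of_real (1 / p) * exp (\<i> * of_real (pi / 2 * (q / p))) * of_real (Gamma (q / p)) \<and>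
         improper_integral_converges (I_minus_integrand p q) \<and>
         I_minus p q = of_real (1 / p) * exp (- \<i> * of_real (pi / 2 * (q / p))) * of_real (Gamma (q / p))"
proof -
  note plus = has_improper_integral_I_plus[OF assms]
  have minus: "has_improper_integral (I_minus_integrand p q)
      (of_real (1 / p) * exp (- \<i> * of_real (pi / 2 * (q / p))) * of_real (Gamma (q / p)))"
    using has_improper_integral_cnj[OF plus] by (simp add: I_minus_integrand_eq_cnj exp_cnj)
  show ?thesis
    unfolding I_plus_def I_minus_def improper_integral_converges_def
    using plus minus improper_integral_eq by blast
qed

end
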